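(* Let $n\ge 3$ and let $\mathcal{H}=P_n^3$ be the $3$-uniform loose hyperpath with $n$ edges. Then the nullvariety $V_0\subset\mathbb{C}^{2n+1}$ of $\mathcal{H}$ can be written as $$V_0=\bigcup_{J\in\mathcal{J}_n}\mathcal{V}(J),$$ and for each $J\in\mathcal{J}_n$ the variety $\mathcal{V}(J)$ is an irreducible component of $V_0$.
   Context: Hyperpath and nullvariety. $P_n^3$ has vertices $v_1,\ldots,v_{2n+1}$ and edges $e_j=\{v_{2j-1},v_{2j},v_{2j+1}\}$ for $j=1,\ldots,n$. Its nullvariety $V_0$ is the affine variety of all $(x_1,\ldots,x_{2n+1})\in\mathbb{C}^{2n+1}$ (origin included) such that for every $i\in\{1,\dots,2n+1\}$, $$\sum_{\{v_i,v_j,v_l\}\in E(P_n^3)}x_jx_l=0,$$ the sum being over edges containing $v_i$. For an ideal $J$, $\mathcal{V}(J)$ is its zero locus in $\mathbb{C}^{2n+1}$. Notation (for $n\ge 3$). Let $A_n'=\{2k+1:1\le k\le n-1\}=\{3,5,\ldots,2n-1\}$ and $A_n=A_n'\setminus\{3,2n-1\}$. For $k\in A_n'$ let $p_k=x_{k-2}x_{k-1}+x_{k+1}x_{k+2}$. Let $\mathcal{F}_n$ be the collection of "Fibonacci subsets" of $A_n'$: the sets $S\subseteq A_n'$ such that for every $k\in\{1,\ldots,n-2\}$, $2k+1\in S$ or $2k+3\in S$. Admissible sets. For $S\in\mathcal{F}_n$, a set $B$ of polynomials is $S$-admissible if $B=U_1\cup U_2\cup U_3\cup U_4$, where: (1)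 $U_1=\{x_i:i\in S\}$. (2) $U_2=\{x_1,x_2\}$ if $x_3\notin U_1$, $x_5\in U_1$; $U_2$ is either $\{x_1\}$ or $\{x_2\}$ (both choices allowed) if $\{x_3,x_5\}\subseteq U_1$; $U_2=\{p_3\}$ if $x_3\in U_1$, $x_5\notin U_1$. (3) $U_3=\{x_{2n},x_{2n+1}\}$ if $x_{2n-1}\notin U_1$, $x_{2n-3}\in U_1$; $U_3$ is either $\{x_{2n}\}$ or $\{x_{2n+1}\}$ (both choices allowed) if $\{x_{2n-3},x_{2n-1}\}\subseteq U_1$; $U_3=\{p_{2n-1}\}$ if $x_{2n-1}\in U_1$, $x_{2n-3}\notin U_1$. (4) $U_4$ is the union over $a\in A_n$ of: $\emptyset$ if $\{x_{a-2},x_{a+2}\}\subseteq U_1$; $\{x_{a+1}\}$ if $x_{a-2}\in U_1$, $x_{a+2}\notin U_1$; $\{x_{a-1}\}$ if $x_{a-2}\notin U_1$, $x_{a+2}\in U_1$; $\{p_a\}$ if $x_{a-2}\notin U_1$ and $x_{a+2}\notin U_1$. Let $\mathcal{T}_S$ be the collection of all $S$-admissible sets. For $B\in\mathcal{T}_S$ let $I_B$ be the ideal of $\mathbb{C}[x_1,\ldots,x_{2n+1}]$ generated by $B$, and let $\mathcal{I}_n=\{I_B:B\in\mathcal{T}_S\text{ for some }S\in\mathcal{F}_n\}$. $\mathcal{J}_n$ is the collection of all ideals $I\in\mathcal{I}_n$ such that $\mathcal{V}(I)$ is inclusion-maximal among the varieties $\{\mathcal{V}(I'):I'\in\mathcal{I}_n\}$.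 *)

theory Defs
  imports Complex_Main "HOL-Library.Poly_Mapping" "HOL-Library.FuncSet" "HOL-Algebra.Ideal"
begin

text \<open>
  Polynomials are elements of the monoid algebra over finitely supported exponent vectors
  \<open>nat \<Rightarrow>\<^sub>0 nat\<close>. The ring in the variables indexed by a set \<open>W\<close> is the subring of those
  polynomials that mention only variables from \<open>W\<close>, and the corresponding affine space
  consists of the functions on \<open>W\<close> (extensional, so that they have no junk values outside).
\<close>

type_synonym cpoly = "(nat \<Rightarrow>\<^sub>0 nat) \<Rightarrow>\<^sub>0 complex"

definition Var :: "nat \<Rightarrow> cpoly" where
  "Var i = Poly_Mapping.single (Poly_Mapping.single i 1) 1"

definition vars :: "cpoly \<Rightarrow> nat set" where
  "vars p = (\<Union>m\<in>Poly_Mapping.keys p. Poly_Mapping.keys m)"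

definition peval :: "(nat \<Rightarrow> complex) \<Rightarrow> cpoly \<Rightarrow> complex" where
  "peval x p = (\<Sum>m\<in>Poly_Mapping.keys p.
     Poly_Mapping.lookup p m * (\<Prod>i\<in>Poly_Mapping.keys m. x i ^ Poly_Mapping.lookup m i))"

definition poly_ring :: "nat set \<Rightarrow> cpoly ring" where
  "poly_ring W = \<lparr>carrier = {p. vars p \<subseteq> W}, mult = (*), one = 1, zero = 0, add = (+)\<rparr>"

text \<open>The carrier is a genuine commutative ring, so \<^const>\<open>genideal\<close> has its intended meaning on it.\<close>

lemma vars_0: "vars 0 = {}" and vars_1: "vars 1 = {}"
  by (simp_all add: vars_def)

lemma vars_uminus: "vars (- f) = vars f"
  by (auto simp: vars_def in_keys_iff)

lemma vars_add: "vars (f + g) \<subseteq> vars f \<union> vars g"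
  unfolding vars_def using Poly_Mapping.keys_add[of f g] by blast

lemma vars_mult: "vars (f * g) \<subseteq> vars f \<union> vars g"
proof
  fix i assume "i \<in> vars (f * g)"
  then obtain m where m: "m \<in> Poly_Mapping.keys (f * g)" "i \<in> Poly_Mapping.keys m"
    by (auto simp: vars_def)
  then obtain a b where "m = a + b" "a \<in> Poly_Mapping.keys f" "b \<in> Poly_Mapping.keys g"
    using keys_mult[of f g] by blast
  then show "i \<in> vars f \<union> vars g"
    using m(2) Poly_Mapping.keys_add[of a b] by (auto simp: vars_def)
qed

lemma cring_poly_ring: "cring (poly_ring W)"
proof (rule cringI)
  have add: "vars (f + g) \<subseteq> W" and mult: "vars (f * g) \<subseteq> W"
    if "vars f \<subseteq> W" "vars g \<subseteq> W" for f g
    using that vars_add[of f g] vars_mult[of f g] by auto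
  have neg: "\<exists>g. vars g \<subseteq> W \<and> f + g = 0" if "vars f \<subseteq> W" for f
    using that by (intro exI[of _ "- f"]) (simp add: vars_uminus)
  show "abelian_group (poly_ring W)"
    by (rule abelian_groupI) (auto simp: poly_ring_def vars_0 add algebra_simps intro: neg)
  show "comm_monoid (poly_ring W)"
    by (rule comm_monoidI) (auto simp: poly_ring_def vars_1 mult algebra_simps intro: subsetD[OF mult])
qed (auto simp: poly_ring_def algebra_simps)

definition affine_space :: "nat set \<Rightarrow> (nat \<Rightarrow> complex) set" where
  "affine_space W = W \<rightarrow>\<^sub>E UNIV"

definition zero_locus :: "nat set \<Rightarrow> cpoly set \<Rightarrow> (nat \<Rightarrow> complex) set" where
  "zero_locus W F = {x \<in> affine_space W. \<forall>f\<in>F. peval x f = 0}"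


definition algebraic_set :: "nat set \<Rightarrow> (nat \<Rightarrow> complex) set \<Rightarrow> bool" where
  "algebraic_set W Z \<longleftrightarrow> (\<exists>F \<subseteq> carrier (poly_ring W). Z = zero_locus W F)"

definition irreducible_set :: "nat set \<Rightarrow> (nat \<Rightarrow> complex) set \<Rightarrow> bool" where
  "irreducible_set W Z \<longleftrightarrow> algebraic_set W Z \<and> Z \<noteq> {} \<and>
     (\<forall>Z1 Z2. algebraic_set W Z1 \<and> algebraic_set W Z2 \<and> Z = Z1 \<union> Z2 \<longrightarrow> Z = Z1 \<or> Z = Z2)"

definition irreducible_component ::
    "nat set \<Rightarrow> (nat \<Rightarrow> complex) set \<Rightarrow> (nat \<Rightarrow> complex) set \<Rightarrow> bool" where
  "irreducible_component W V Z \<longleftrightarrow> irreducible_set W Z \<and> Z \<subseteq> V \<and>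
     (\<forall>Z'. irreducible_set W Z' \<and> Z \<subseteq> Z' \<and> Z' \<subseteq> V \<longrightarrow> Z' = Z)"


text \<open>The vertex \<open>v\<^sub>i\<close> of a hypergraph is represented by its index \<open>i\<close>.\<close>

definition hyperpath_verts :: "nat \<Rightarrow> nat set" where
  "hyperpath_verts n = {1..2*n+1}"

definition hyperpath_edges :: "nat \<Rightarrow> nat set set" where
  "hyperpath_edges n = (\<lambda>j. {2*j-1, 2*j, 2*j+1}) ` {1..n}"

definition nullvariety :: "nat set \<Rightarrow> nat set set \<Rightarrow> (nat \<Rightarrow> complex) set" where
  "nullvariety W E =
     {x \<in> affine_space W. \<forall>i\<in>W. (\<Sum>e\<in>{e\<in>E. i \<in> e}. \<Prod>j\<in>e - {i}. x j) = 0}"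


definition A_n' :: "nat \<Rightarrow> nat set" where
  "A_n' n = {2*k+1 | k. 1 \<le> k \<and> k \<le> n-1}"

definition A_n :: "nat \<Rightarrow> nat set" where
  "A_n n = A_n' n - {3, 2*n-1}"

definition p_k :: "nat \<Rightarrow> cpoly" where
  "p_k k = Var (k-2) * Var (k-1) + Var (k+1) * Var (k+2)"

definition fibonacci_subsets :: "nat \<Rightarrow> nat set set" where
  "fibonacci_subsets n = {S. S \<subseteq> A_n' n \<and> (\<forall>k\<in>{1..n-2}. 2*k+1 \<in> S \<or> 2*k+3 \<in> S)}"

definition U1 :: "nat set \<Rightarrow> cpoly set" where
  "U1 S = Var ` S"

text \<open>
  \<open>U2_choices\<close> and \<open>U3_choices\<close> collect the possible values of \<open>U\<^sub>2\<close> and \<open>U\<^sub>3\<close>; the final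
  \<open>else\<close> cases (no admissible choice) cannot occur for Fibonacci subsets when \<open>n \<ge> 3\<close>.
\<close>

definition U2_choices :: "nat set \<Rightarrow> cpoly set set" where
  "U2_choices S =
     (if Var 3 \<notin> U1 S \<and> Var 5 \<in> U1 S then {{Var 1, Var 2}}
      else if Var 3 \<in> U1 S \<and> Var 5 \<in> U1 S then {{Var 1}, {Var 2}}
      else if Var 3 \<in> U1 S \<and> Var 5 \<notin> U1 S then {{p_k 3}}
      else {})"

definition U3_choices :: "nat \<Rightarrow> nat set \<Rightarrow> cpoly set set" where
  "U3_choices n S =
     (if Var (2*n-1) \<notin> U1 S \<and> Var (2*n-3) \<in> U1 S then {{Var (2*n), Var (2*n+1)}}
      else if Var (2*n-3) \<in> U1 S \<and> Var (2*n-1) \<in> U1 S then {{Var (2*n)}, {Var (2*n+1)}}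
      else if Var (2*n-1) \<in> U1 S \<and> Var (2*n-3) \<notin> U1 S then {{p_k (2*n-1)}}
      else {})"

definition U4 :: "nat \<Rightarrow> nat set \<Rightarrow> cpoly set" where
  "U4 n S = (\<Union>a\<in>A_n n.
      if Var (a-2) \<in> U1 S \<and> Var (a+2) \<in> U1 S then {}
      else if Var (a-2) \<in> U1 S \<and> Var (a+2) \<notin> U1 S then {Var (a+1)}
      else if Var (a-2) \<notin> U1 S \<and> Var (a+2) \<in> U1 S then {Var (a-1)}
      else {p_k a})"

definition admissible_sets :: "nat \<Rightarrow> nat set \<Rightarrow> cpoly set set" where
  "admissible_sets n S =
     {U1 S \<union> U2 \<union> U3 \<union> U4 n S | U2 U3. U2 \<in> U2_choices S \<and> U3 \<in> U3_choices n S}"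

definition admissible_ideals :: "nat \<Rightarrow> cpoly set set" where
  "admissible_ideals n =
     {Idl\<^bsub>poly_ring (hyperpath_verts n)\<^esub> B | B S.
        S \<in> fibonacci_subsets n \<and> B \<in> admissible_sets n S}"

definition maximal_variety_ideals :: "nat \<Rightarrow> cpoly set set" where
  "maximal_variety_ideals n = {I \<in> admissible_ideals n. \<forall>I'\<in>admissible_ideals n.
     zero_locus (hyperpath_verts n) I \<subseteq> zero_locus (hyperpath_verts n) I' \<longrightarrow>
     zero_locus (hyperpath_verts n) I' = zero_locus (hyperpath_verts n) I}"

end

theory Submission
  imports Defs "HOL-Computational_Algebra.Polynomial"
begin

text \<open>
  The edge equations say that two odd vertices of one edge never both carry a nonzero value, that
  the two leaves of an end edge can be nonzero only if the inner end vertex is zero, and that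
  \<open>p\<^sub>a = 0\<close> at every vertex \<open>a\<close> common to two edges. For a point \<open>x\<close> of the nullvariety, the
  set \<open>S\<close> of inner odd vertices where \<open>x\<close> vanishes is therefore a Fibonacci subset. After setting
  the coordinates in \<open>S\<close> to zero and cancelling the nonzero odd coordinates outside \<open>S\<close>, what
  remains of the equations is that the generators of some admissible set vanish at \<open>x\<close>; an
  equation \<open>x\<^sub>1 x\<^sub>2 = 0\<close> left over at an end edge is the reason for the choices there. Conversely
  the generators of an admissible set imply all the equations. Hence the nullvariety is the union
  of the finitely many admissible varieties
  (\<open>nullvariety_eq_Union_admissible\<close>).

  The main point is that every admissible variety is irreducible. It is cut out by vanishing
  coordinates and by relations \<open>p\<^sub>a = x\<^sub>a\<^sub>-\<^sub>2 x\<^sub>a\<^sub>-\<^sub>1 + x\<^sub>a\<^sub>+\<^sub>1 x\<^sub>a\<^sub>+\<^sub>2\<close> in other coordinates, and the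
  indices \<open>a\<close> are at least \<open>4\<close> apart (\<open>admissible_set_shape\<close>). So in increasing order each
  relation has the form \<open>c u + v y = 0\<close>, where \<open>u\<close>, \<open>v\<close>, \<open>y\<close> are coordinates on which the
  earlier equations put no condition, and only \<open>c\<close> may occur in them. Adjoining such a relation
  to an irreducible set \<open>Z\<close> keeps it irreducible when \<open>c\<close> is not identically zero on \<open>Z\<close>
  (\<open>integral_on_adjoin_relation\<close>). The part with \<open>v \<noteq> 0\<close> is covered by the polynomial map
  \<open>u = - s v, y = c s\<close> and the part with \<open>y \<noteq> 0\<close> by \<open>u = - s y, v = c s\<close>. Images of irreducible
  sets are irreducible; the two images overlap in a dense part of each because \<open>c\<close> is not
  identically zero; and points with \<open>v = y = 0\<close> are limits of points with \<open>v \<noteq> 0\<close>, since \<open>v\<close>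
  is unrestricted there.

  The rest is the general fact that in a finite union of irreducible sets the maximal members
  are the irreducible components (\<open>maximal_members_are_irreducible_components\<close>).
\<close>

section \<open>Evaluation of polynomials\<close>

lemma peval_eq_sum_superset:
  assumes "finite K" "Poly_Mapping.keys p \<subseteq> K"
  shows "peval x p = (\<Sum>m\<in>K. Poly_Mapping.lookup p m *
    (\<Prod>i\<in>Poly_Mapping.keys m. x i ^ Poly_Mapping.lookup m i))"
  unfolding peval_def
  by (rule sum.mono_neutral_left) (use assms in \<open>auto simp: in_keys_iff\<close>)

lemma peval_0 [simp]: "peval x 0 = 0"
  by (simp add: peval_def)

lemma peval_1 [simp]: "peval x 1 = 1"
  by (simp add: peval_def)

lemma peval_add [simp]: "peval x (p + q) = peval x p + peval x q"
proof -
  let ?K = "Poly_Mapping.keys p \<union> Poly_Mapping.keys q"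
  have "finite ?K" by simp
  moreover have "Poly_Mapping.keys (p + q) \<subseteq> ?K" by (rule Poly_Mapping.keys_add)
  ultimately show ?thesis
    by (simp add: peval_eq_sum_superset[of ?K] lookup_add distrib_right sum.distrib)
qed

lemma peval_single:
  "peval x (Poly_Mapping.single m c) =
    c * (\<Prod>i\<in>Poly_Mapping.keys m. x i ^ Poly_Mapping.lookup m i)"
  by (cases "c = 0") (simp_all add: peval_def)

lemma monomial_value_add:
  fixes x :: "nat \<Rightarrow> complex" and m m' :: "nat \<Rightarrow>\<^sub>0 nat"
  shows "(\<Prod>i\<in>Poly_Mapping.keys (m + m'). x i ^ Poly_Mapping.lookup (m + m') i) =
         (\<Prod>i\<in>Poly_Mapping.keys m. x i ^ Poly_Mapping.lookup m i) *
         (\<Prod>i\<in>Poly_Mapping.keys m'. x i ^ Poly_Mapping.lookup m' i)"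
proof -
  let ?K = "Poly_Mapping.keys m \<union> Poly_Mapping.keys m'"
  have ext: "(\<Prod>i\<in>Poly_Mapping.keys k. x i ^ Poly_Mapping.lookup k i) =
      (\<Prod>i\<in>?K. x i ^ Poly_Mapping.lookup k i)"
    if "Poly_Mapping.keys k \<subseteq> ?K" for k :: "nat \<Rightarrow>\<^sub>0 nat"
    by (rule prod.mono_neutral_left) (use that in \<open>auto simp: in_keys_iff\<close>)
  show ?thesis
    unfolding ext[OF Poly_Mapping.keys_add] ext[OF Un_upper1] ext[OF Un_upper2]
    by (simp add: lookup_add power_add prod.distrib)
qed

lemma monomial_induct [case_names zero single add]:
  fixes p :: "'a \<Rightarrow>\<^sub>0 'b::comm_monoid_add"
  assumes "P 0" "\<And>m c. P (Poly_Mapping.single m c)" "\<And>p q. P p \<Longrightarrow> P q \<Longrightarrow> P (p + q)"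
  shows "P p"
proof -
  have "P (\<Sum>m\<in>K. Poly_Mapping.single m (Poly_Mapping.lookup p m))" if "finite K" for K
    using that by induction (auto intro: assms)
  moreover have "p = (\<Sum>m\<in>Poly_Mapping.keys p. Poly_Mapping.single m (Poly_Mapping.lookup p m))"
    by (rule poly_mapping_eqI)
      (simp add: lookup_sum lookup_single when_def in_keys_iff)
  ultimately show ?thesis by (metis finite_keys)
qed

lemma peval_mult [simp]: "peval x (p * q) = peval x p * peval x q"
proof (induction p rule: monomial_induct)
  case (single m c)
  show ?case
    by (induction q rule: monomial_induct)
      (simp_all add: mult_single peval_single monomial_value_add distrib_left)
qed (simp_all add: distrib_right)

lemma peval_Var [simp]: "peval x (Var i) = x i"
  by (simp add: Var_def peval_single)

lemma peval_p_k [simp]: "peval x (p_k k) = x (k-2) * x (k-1) + x (k+1) * x (k+2)"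
  by (simp add: p_k_def)

lemma Var_eq_iff [simp]: "Var i = Var j \<longleftrightarrow> i = j"
proof
  assume "Var i = Var j"
  then have "peval (\<lambda>l. of_bool (l = i)) (Var i) = peval (\<lambda>l. of_bool (l = i)) (Var j)" by simp
  then show "i = j" by (simp split: if_splits)
qed simp

lemma vars_Var: "vars (Var i) = {i}"
  by (simp add: vars_def Var_def)

lemma vars_p_k: "vars (p_k k) \<subseteq> {k-2, k-1, k+1, k+2}"
  unfolding p_k_def
  using vars_add[of "Var (k-2) * Var (k-1)" "Var (k+1) * Var (k+2)"]
    vars_mult[of "Var (k-2)" "Var (k-1)"] vars_mult[of "Var (k+1)" "Var (k+2)"]
  by (auto simp: vars_Var)

section \<open>Algebraic sets\<close>

text \<open>The polynomials vanishing at a point form an ideal, so an ideal has the zeros of its generators.\<close>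

lemma zero_locus_genideal:
  assumes "B \<subseteq> carrier (poly_ring W)"
  shows "zero_locus W (Idl\<^bsub>poly_ring W\<^esub> B) = zero_locus W B"
proof
  interpret R: cring "poly_ring W" by (rule cring_poly_ring)
  show "zero_locus W (Idl\<^bsub>poly_ring W\<^esub> B) \<subseteq> zero_locus W B"
    using R.genideal_self[OF assms] by (auto simp: zero_locus_def)
  have "ideal {f \<in> carrier (poly_ring W). peval x f = 0} (poly_ring W)" for x
  proof (rule idealI)
    show "ring (poly_ring W)" by (rule R.ring_axioms)
    show "subgroup {f \<in> carrier (poly_ring W). peval x f = 0} (add_monoid (poly_ring W))"
    proof (rule R.add.subgroupI)
      fix f assume f: "f \<in> {f \<in> carrier (poly_ring W). peval x f = 0}"
      then have "f \<oplus>\<^bsub>poly_ring W\<^esub> (\<ominus>\<^bsub>poly_ring W\<^esub> f) = \<zero>\<^bsub>poly_ring W\<^esub>"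
        by (intro R.r_neg) simp
      then have "f + \<ominus>\<^bsub>poly_ring W\<^esub> f = 0" by (simp add: poly_ring_def)
      then have "peval x (f + \<ominus>\<^bsub>poly_ring W\<^esub> f) = 0" by simp
      then have "peval x (\<ominus>\<^bsub>poly_ring W\<^esub> f) = 0" using f by simp
      then show "\<ominus>\<^bsub>poly_ring W\<^esub> f \<in> {f \<in> carrier (poly_ring W). peval x f = 0}"
        using f by simp
    next
      show "{f \<in> carrier (poly_ring W). peval x f = 0} \<noteq> {}"
        using R.zero_closed by (auto simp: poly_ring_def vars_0 intro!: exI[of _ 0])
    qed (auto simp: poly_ring_def dest: subsetD[OF vars_add])
  qed (auto simp: poly_ring_def dest: subsetD[OF vars_mult])
  then have "Idl\<^bsub>poly_ring W\<^esub> B \<subseteq> {f \<in> carrier (poly_ring W). peval x f = 0}"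
    if "x \<in> zero_locus W B" for x
    using that assms by (intro R.genideal_minimal) (auto simp: zero_locus_def)
  then show "zero_locus W B \<subseteq> zero_locus W (Idl\<^bsub>poly_ring W\<^esub> B)"
    unfolding zero_locus_def by blast
qed

lemma algebraic_set_Int:
  assumes "algebraic_set W Z1" "algebraic_set W Z2"
  shows "algebraic_set W (Z1 \<inter> Z2)"
proof -
  obtain F G where "F \<subseteq> carrier (poly_ring W)" "G \<subseteq> carrier (poly_ring W)"
    "Z1 = zero_locus W F" "Z2 = zero_locus W G"
    using assms by (auto simp: algebraic_set_def)
  then show ?thesis
    unfolding algebraic_set_def by (intro exI[of _ "F \<union> G"]) (auto simp: zero_locus_def)
qed

text \<open>The products \<open>f g\<close> cut out the union, since the complex numbers have no zero divisors.\<close>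

lemma algebraic_set_Un:
  assumes "algebraic_set W Z1" "algebraic_set W Z2"
  shows "algebraic_set W (Z1 \<union> Z2)"
proof -
  obtain F G where *: "F \<subseteq> carrier (poly_ring W)" "G \<subseteq> carrier (poly_ring W)"
    "Z1 = zero_locus W F" "Z2 = zero_locus W G"
    using assms by (auto simp: algebraic_set_def)
  let ?H = "{f * g | f g. f \<in> F \<and> g \<in> G}"
  have "?H \<subseteq> carrier (poly_ring W)"
  proof
    fix h assume "h \<in> ?H"
    then obtain f g where "h = f * g" "vars f \<subseteq> W" "vars g \<subseteq> W"
      using *(1,2) unfolding poly_ring_def by auto blast
    then show "h \<in> carrier (poly_ring W)"
      using vars_mult[of f g] by (auto simp: poly_ring_def)
  qed
  moreover have "Z1 \<union> Z2 = zero_locus W ?H"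
  proof
    show "Z1 \<union> Z2 \<subseteq> zero_locus W ?H"
      unfolding *(3,4) by (auto simp: zero_locus_def)
    show "zero_locus W ?H \<subseteq> Z1 \<union> Z2"
    proof
      fix x assume x: "x \<in> zero_locus W ?H"
      then have "peval x f = 0 \<or> peval x g = 0" if "f \<in> F" "g \<in> G" for f g
        using that peval_mult[of x f g] unfolding zero_locus_def by fastforce
      with x show "x \<in> Z1 \<union> Z2"
        unfolding *(3,4) zero_locus_def by blast
    qed
  qed
  ultimately show ?thesis unfolding algebraic_set_def by blast
qed

lemma algebraic_set_empty: "algebraic_set W {}"
  unfolding algebraic_set_def
  by (intro exI[of _ "{1}"]) (simp add: zero_locus_def poly_ring_def vars_1)

lemma algebraic_set_Union:
  assumes "finite C" "\<And>Z. Z \<in> C \<Longrightarrow> algebraic_set W Z"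
  shows "algebraic_set W (\<Union>C)"
  using assms by induction (auto intro: algebraic_set_empty algebraic_set_Un)

lemma irreducible_set_algebraic: "irreducible_set W Z \<Longrightarrow> algebraic_set W Z"
  by (simp add: irreducible_set_def)

lemma irreducible_set_subset_Union:
  assumes "finite C" "\<And>Y. Y \<in> C \<Longrightarrow> algebraic_set W Y"
    and "irreducible_set W Z" "Z \<subseteq> \<Union>C"
  shows "\<exists>Y\<in>C. Z \<subseteq> Y"
  using assms(1,2,4)
proof induction
  case empty
  then show ?case using assms(3) by (simp add: irreducible_set_def)
next
  case (insert Y C)
  have alg: "algebraic_set W (Z \<inter> Y)" "algebraic_set W (Z \<inter> \<Union>C)"
    using algebraic_set_Int[OF irreducible_set_algebraic[OF assms(3)]] insert.prems(1)
      algebraic_set_Union[OF insert.hyps(1)] by simp_all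
  have "Z = (Z \<inter> Y) \<union> (Z \<inter> \<Union>C)" using insert.prems by blast
  then have "Z = Z \<inter> Y \<or> Z = Z \<inter> \<Union>C"
    using assms(3) alg unfolding irreducible_set_def by blast
  then show ?case
  proof
    assume "Z = Z \<inter> \<Union>C"
    then have "Z \<subseteq> \<Union>C" by blast
    with insert.IH insert.prems(1) show ?thesis by blast
  qed blast
qed

text \<open>
  An irreducible set inside a finite union of algebraic sets lies in one of them, so no
  irreducible subset of the union is strictly larger than a maximal member.
\<close>

lemma maximal_members_are_irreducible_components:
  assumes fin: "finite C" and irr: "\<And>Z. Z \<in> C \<Longrightarrow> irreducible_set W Z"
    and Z: "Z \<in> C" and max: "\<And>Y. Y \<in> C \<Longrightarrow> Z \<subseteq> Y \<Longrightarrow> Y = Z"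
  shows "irreducible_component W (\<Union>C) Z"
  unfolding irreducible_component_def
proof (intro conjI allI impI)
  fix Z' assume Z': "irreducible_set W Z' \<and> Z \<subseteq> Z' \<and> Z' \<subseteq> \<Union>C"
  then obtain Y where "Y \<in> C" "Z' \<subseteq> Y"
    using irreducible_set_subset_Union[OF fin] irreducible_set_algebraic[OF irr] by meson
  then show "Z' = Z" using max Z' by blast
qed (use irr Z in auto)

section \<open>Polynomial functions and integral point sets\<close>

text \<open>
  Irreducibility is decided with functions instead of formal polynomials, because functions can
  be composed with polynomial maps and restricted to lines.
\<close>

inductive_set polyfuns :: "((nat \<Rightarrow> complex) \<Rightarrow> complex) set" where
  const: "(\<lambda>x. c) \<in> polyfuns"
| coord: "(\<lambda>x. x i) \<in> polyfuns"
| add: "f \<in> polyfuns \<Longrightarrow> g \<in> polyfuns \<Longrightarrow> (\<lambda>x. f x + g x) \<in> polyfuns"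
| mult: "f \<in> polyfuns \<Longrightarrow> g \<in> polyfuns \<Longrightarrow> (\<lambda>x. f x * g x) \<in> polyfuns"

lemma polyfuns_sum:
  "finite A \<Longrightarrow> (\<And>a. a \<in> A \<Longrightarrow> f a \<in> polyfuns) \<Longrightarrow> (\<lambda>x. \<Sum>a\<in>A. f a x) \<in> polyfuns"
  by (induction rule: finite_induct) (auto intro: polyfuns.intros)

lemma polyfuns_prod:
  "finite A \<Longrightarrow> (\<And>a. a \<in> A \<Longrightarrow> f a \<in> polyfuns) \<Longrightarrow> (\<lambda>x. \<Prod>a\<in>A. f a x) \<in> polyfuns"
  by (induction rule: finite_induct) (auto intro: polyfuns.intros)

lemma polyfuns_power: "f \<in> polyfuns \<Longrightarrow> (\<lambda>x. f x ^ k) \<in> polyfuns"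
  by (induction k) (auto intro: polyfuns.intros)

lemma polyfuns_uminus: "f \<in> polyfuns \<Longrightarrow> (\<lambda>x. - f x) \<in> polyfuns"
  using polyfuns.mult[OF polyfuns.const[of "-1"], of f] by simp

lemma peval_polyfun: "(\<lambda>x. peval x p) \<in> polyfuns"
  unfolding peval_def by (intro polyfuns_sum polyfuns_prod polyfuns_power polyfuns.intros) auto

lemma polyfuns_compose:
  assumes "f \<in> polyfuns" "\<And>i. (\<lambda>x. \<phi> x i) \<in> polyfuns"
  shows "(\<lambda>x. f (\<phi> x)) \<in> polyfuns"
  using assms by induction (auto intro: polyfuns.intros)

lemma polyfun_on_line:
  assumes "f \<in> polyfuns"
  shows "\<exists>p. \<forall>t. f (\<lambda>i. a i + t * b i) = poly p t"
  using assms
proof induction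
  case (const c)
  show ?case by (intro exI[of _ "[:c:]"]) simp
next
  case (coord i)
  show ?case by (intro exI[of _ "[:a i, b i:]"]) simp
next
  case (add f g)
  then obtain p q where "\<forall>t. f (\<lambda>i. a i + t * b i) = poly p t" "\<forall>t. g (\<lambda>i. a i + t * b i) = poly q t"
    by blast
  then show ?case by (intro exI[of _ "p + q"]) simp
next
  case (mult f g)
  then obtain p q where "\<forall>t. f (\<lambda>i. a i + t * b i) = poly p t" "\<forall>t. g (\<lambda>i. a i + t * b i) = poly q t"
    by blast
  then show ?case by (intro exI[of _ "p * q"]) simp
qed

text \<open>
  For an algebraic set this says that its coordinate ring has no zero divisors. It is formulated
  for arbitrary point sets so that it also applies to images of polynomial maps, which need not
  be closed.
\<close>

definition integral_on :: "(nat \<Rightarrow> complex) set \<Rightarrow> bool" where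
  "integral_on X \<longleftrightarrow> (\<forall>f\<in>polyfuns. \<forall>g\<in>polyfuns. (\<forall>x\<in>X. f x * g x = 0) \<longrightarrow>
     (\<forall>x\<in>X. f x = 0) \<or> (\<forall>x\<in>X. g x = 0))"

lemma integral_onD:
  "integral_on X \<Longrightarrow> f \<in> polyfuns \<Longrightarrow> g \<in> polyfuns \<Longrightarrow> (\<And>x. x \<in> X \<Longrightarrow> f x * g x = 0) \<Longrightarrow>
    (\<forall>x\<in>X. f x = 0) \<or> (\<forall>x\<in>X. g x = 0)"
  unfolding integral_on_def by blast

text \<open>
  If \<open>f\<close> does not vanish at \<open>a\<close> and \<open>g\<close> does not vanish at \<open>b\<close>, then both are nonzero
  univariate polynomials on the line through \<open>a\<close> and \<open>b\<close>, so their product is nonzero there.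
\<close>

lemma integral_on_if_lines:
  assumes lines: "\<And>a b t. a \<in> X \<Longrightarrow> b \<in> X \<Longrightarrow> (\<lambda>i. a i + t * (b i - a i)) \<in> X"
  shows "integral_on X"
  unfolding integral_on_def
proof (intro ballI impI)
  fix f g assume fg: "f \<in> polyfuns" "g \<in> polyfuns" and prod: "\<forall>x\<in>X. f x * g x = 0"
  show "(\<forall>x\<in>X. f x = 0) \<or> (\<forall>x\<in>X. g x = 0)"
  proof (rule ccontr)
    assume "\<not> ?thesis"
    then obtain a b where ab: "a \<in> X" "b \<in> X" "f a \<noteq> 0" "g b \<noteq> 0" by blast
    define l where "l t = (\<lambda>i. a i + t * (b i - a i))" for t
    obtain p q where p: "\<And>t. f (l t) = poly p t" and q: "\<And>t. g (l t) = poly q t"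
      unfolding l_def using polyfun_on_line[OF fg(1)] polyfun_on_line[OF fg(2)] by metis
    have "l 0 = a" "l 1 = b" by (auto simp: l_def)
    then have "p \<noteq> 0" "q \<noteq> 0" using p[of 0] q[of 1] ab by auto
    moreover have "poly (p * q) t = 0" for t
      using prod lines[OF ab(1,2)] by (simp add: p[symmetric] q[symmetric] l_def)
    then have "p * q = 0" by (simp add: poly_all_0_iff_0[symmetric])
    ultimately show False by simp
  qed
qed

lemma integral_on_image:
  assumes "integral_on X" "\<And>i. (\<lambda>x. \<phi> x i) \<in> polyfuns"
  shows "integral_on (\<phi> ` X)"
  unfolding integral_on_def
proof (intro ballI impI)
  fix f g assume fg: "f \<in> polyfuns" "g \<in> polyfuns" and "\<forall>y\<in>\<phi> ` X. f y * g y = 0"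
  then have "f (\<phi> x) * g (\<phi> x) = 0" if "x \<in> X" for x using that by blast
  from integral_onD[OF assms(1) polyfuns_compose[OF fg(1) assms(2)]
      polyfuns_compose[OF fg(2) assms(2)] this]
  show "(\<forall>y\<in>\<phi> ` X. f y = 0) \<or> (\<forall>y\<in>\<phi> ` X. g y = 0)" by simp
qed

text \<open>Irreducibility passes from a set to any set in its Zariski closure that contains it.\<close>

lemma integral_on_dense:
  assumes "integral_on X" "X \<subseteq> Y"
    and "\<And>f. f \<in> polyfuns \<Longrightarrow> (\<And>x. x \<in> X \<Longrightarrow> f x = 0) \<Longrightarrow> (\<And>x. x \<in> Y \<Longrightarrow> f x = 0)"
  shows "integral_on Y"
  unfolding integral_on_def
proof (intro ballI impI)
  fix f g assume fg: "f \<in> polyfuns" "g \<in> polyfuns" and "\<forall>y\<in>Y. f y * g y = 0"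
  then have "f x * g x = 0" if "x \<in> X" for x using that assms(2) by blast
  from integral_onD[OF assms(1) fg this]
  show "(\<forall>y\<in>Y. f y = 0) \<or> (\<forall>y\<in>Y. g y = 0)" using assms(3) fg by blast
qed

text \<open>
  A univariate polynomial with all nonzero numbers as roots is zero. This takes the place of a
  continuity argument.
\<close>

lemma polyfun_zero_if_zero_nearby:
  assumes f: "f \<in> polyfuns" and nearby: "\<And>t. t \<noteq> 0 \<Longrightarrow> f (x(v := t)) = 0" and "x v = 0"
  shows "f x = 0"
proof -
  obtain p where p: "\<And>t. f (\<lambda>i. x i + t * of_bool (i = v)) = poly p t"
    using polyfun_on_line[OF f, of x "\<lambda>i. of_bool (i = v)"] by auto
  have line: "(\<lambda>i. x i + t * of_bool (i = v)) = x(v := t)" for t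
    using \<open>x v = 0\<close> by auto
  have "poly p t = 0" if "t \<noteq> 0" for t using nearby[OF that] p[of t] by (simp add: line)
  then have "poly (p * [:0, 1:]) t = 0" for t by (cases "t = 0") auto
  then have "p * [:0, 1:] = 0" by (simp add: poly_all_0_iff_0[symmetric])
  then have "p = 0" by simp
  then show ?thesis using p[of 0] \<open>x v = 0\<close> by simp
qed

lemma irreducible_set_if_integral_on:
  assumes alg: "algebraic_set W Z" and ne: "Z \<noteq> {}" and int: "integral_on Z"
  shows "irreducible_set W Z"
  unfolding irreducible_set_def
proof (intro conjI allI impI alg ne)
  fix Z1 Z2 assume *: "algebraic_set W Z1 \<and> algebraic_set W Z2 \<and> Z = Z1 \<union> Z2"
  then obtain F G where FG: "Z1 = zero_locus W F" "Z2 = zero_locus W G"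
    by (auto simp: algebraic_set_def)
  have aff: "Z \<subseteq> affine_space W" using alg by (auto simp: algebraic_set_def zero_locus_def)
  show "Z = Z1 \<or> Z = Z2"
  proof (rule ccontr)
    assume "\<not> ?thesis"
    then obtain a b where "a \<in> Z" "a \<notin> Z1" "b \<in> Z" "b \<notin> Z2" using * by blast
    then obtain f g where fg: "f \<in> F" "peval a f \<noteq> 0" "g \<in> G" "peval b g \<noteq> 0"
      using aff by (auto simp: FG zero_locus_def)
    have "peval x f * peval x g = 0" if "x \<in> Z" for x
      using that * fg by (auto simp: FG zero_locus_def)
    then show False
      using integral_onD[OF int peval_polyfun peval_polyfun, of f g] fg \<open>a \<in> Z\<close> \<open>b \<in> Z\<close> by blast
  qed
qed

section \<open>Adjoining one quadratic relation\<close>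

text \<open>
  The set \<open>c u + v y = 0\<close> over \<open>Z\<close> is covered, up to the points with \<open>v = y = 0\<close>, by the images
  of \<open>\<phi>\<close> and \<open>\<psi>\<close> below, which are irreducible because \<open>Z\<close> is. It suffices that the image of
  \<open>\<phi>\<close> is dense. A function vanishing there also vanishes at the points of the image of \<open>\<psi>\<close> with
  \<open>v \<noteq> 0\<close>; these exist by the assumption on \<open>c\<close>, so it vanishes on all of that image. The
  remaining points are reached by moving the coordinate \<open>v\<close> away from \<open>0\<close>. Without the
  assumption on \<open>c\<close> the relation could degenerate to \<open>v y = 0\<close>, which is reducible.
\<close>

lemma integral_on_adjoin_relation:
  assumes int: "integral_on Z"
    and distinct: "distinct [c, u, v, y]"
    and free: "\<And>x s i. x \<in> Z \<Longrightarrow> i \<in> {u, v, y} \<Longrightarrow> x(i := s) \<in> Z"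
    and x0: "x0 \<in> Z" "x0 c \<noteq> 0"
  shows "integral_on {x \<in> Z. x c * x u + x v * x y = 0}"
proof -
  define Y where "Y = {x \<in> Z. x c * x u + x v * x y = 0}"
  define \<phi> where "\<phi> x = x(u := - (x u * x v), y := x c * x u)" for x :: "nat \<Rightarrow> complex"
  define \<psi> where "\<psi> x = x(u := - (x u * x y), v := x c * x u)" for x :: "nat \<Rightarrow> complex"
  have "(\<lambda>x. \<phi> x i) \<in> polyfuns" "(\<lambda>x. \<psi> x i) \<in> polyfuns" for i
    unfolding \<phi>_def \<psi>_def fun_upd_def
    by (cases "i = u"; cases "i = v"; cases "i = y";
        simp; intro polyfuns.intros polyfuns_uminus)+
  then have int_images: "integral_on (\<phi> ` Z)" "integral_on (\<psi> ` Z)"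
    by (auto intro!: integral_on_image int)
  have sub: "\<phi> ` Z \<subseteq> Y" "\<psi> ` Z \<subseteq> Y"
    using distinct by (auto simp: Y_def \<phi>_def \<psi>_def intro!: free)
  \<comment> \<open>The coordinate \<open>u\<close> is free on \<open>Z\<close>, so it can carry the parameter \<open>s = - u / v\<close>.\<close>
  have cover_\<phi>: "x \<in> \<phi> ` Z" if "x \<in> Y" "x v \<noteq> 0" for x
  proof
    have "x c * x u = - (x v * x y)" using that by (simp add: Y_def eq_neg_iff_add_eq_0)
    then show "x = \<phi> (x(u := - x u / x v))"
      using that distinct by (auto simp: \<phi>_def fun_eq_iff)
    show "x(u := - x u / x v) \<in> Z" using that by (auto simp: Y_def intro!: free)
  qed
  have cover_\<psi>: "x \<in> \<psi> ` Z" if "x \<in> Y" "x y \<noteq> 0" for x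
  proof
    have "x c * x u = - (x v * x y)" using that by (simp add: Y_def eq_neg_iff_add_eq_0)
    then show "x = \<psi> (x(u := - x u / x y))"
      using that distinct by (auto simp: \<psi>_def fun_eq_iff)
    show "x(u := - x u / x y) \<in> Z" using that by (auto simp: Y_def intro!: free)
  qed
  have "f x = 0" if f: "f \<in> polyfuns" "\<And>x. x \<in> \<phi> ` Z \<Longrightarrow> f x = 0" and x: "x \<in> Y" for f x
  proof -
    \<comment> \<open>Irreducibility of the second image transfers the vanishing from its part in the first.\<close>
    have "f z * z v = 0" if "z \<in> \<psi> ` Z" for z
      using f(2)[of z] cover_\<phi>[of z] that sub by auto
    then have "(\<forall>z\<in>\<psi> ` Z. f z = 0) \<or> (\<forall>z\<in>\<psi> ` Z. z v = 0)"
      by (rule integral_onD[OF int_images(2) f(1) polyfuns.coord])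
    moreover have "\<psi> (x0(u := 1)) \<in> \<psi> ` Z" using x0 by (intro imageI free) auto
    moreover have "\<psi> (x0(u := 1)) v \<noteq> 0" using x0 distinct by (auto simp: \<psi>_def)
    ultimately have \<psi>0: "\<And>z. z \<in> \<psi> ` Z \<Longrightarrow> f z = 0" by blast
    show "f x = 0"
    proof (cases "x v = 0 \<and> x y = 0")
      case True
      have "x(v := t) \<in> Y" for t
        using x True distinct by (auto simp: Y_def intro!: free)
      then have "f (x(v := t)) = 0" if "t \<noteq> 0" for t
        using f(2) cover_\<phi>[of "x(v := t)"] that by simp
      then show ?thesis using polyfun_zero_if_zero_nearby[OF f(1)] True by blast
    next
      case False
      then show ?thesis using cover_\<phi> cover_\<psi> \<psi>0 f(2) x by blast
    qed
  qed
  then have "integral_on Y" by (rule integral_on_dense[OF int_images(1) sub(1)]) auto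
  then show ?thesis by (simp add: Y_def)
qed

section \<open>Chains of quadratic relations\<close>

definition chain_locus :: "nat set \<Rightarrow> nat set \<Rightarrow> (nat \<Rightarrow> complex) set" where
  "chain_locus N Q = {x. (\<forall>i\<in>N. x i = 0) \<and> (\<forall>a\<in>Q. x (a-2) * x (a-1) + x (a+1) * x (a+2) = 0)}"

text \<open>
  Taking the relations in increasing order of their index makes \<open>x\<^sub>b\<^sub>-\<^sub>2\<close> the only coordinate that
  the relation at \<open>b\<close> can share with earlier ones: two relations at distance exactly \<open>4\<close> have
  one coordinate in common.
\<close>

lemma integral_on_chain_locus:
  assumes "finite Q"
    and "\<And>a. a \<in> Q \<Longrightarrow> 2 \<le> a \<and> N \<inter> {a-2, a-1, a+1, a+2} = {}"
    and "\<And>a b. a \<in> Q \<Longrightarrow> b \<in> Q \<Longrightarrow> a < b \<Longrightarrow> a + 4 \<le> b"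
  shows "integral_on (chain_locus N Q)"
  using assms
proof (induction rule: finite_linorder_max_induct)
  case empty
  show ?case by (rule integral_on_if_lines) (auto simp: chain_locus_def)
next
  case (insert b Q)
  have b: "2 \<le> b" "N \<inter> {b-2, b-1, b+1, b+2} = {}" and gap: "\<And>a. a \<in> Q \<Longrightarrow> a + 4 \<le> b"
    and two: "\<And>a. a \<in> Q \<Longrightarrow> 2 \<le> a"
    using insert.prems insert.hyps by auto
  let ?Z = "chain_locus N Q"
  have int: "integral_on ?Z" using insert by auto
  have free: "x(i := s) \<in> ?Z" if "x \<in> ?Z" "i \<in> {b-1, b+1, b+2}" for x s i
  proof -
    have "i \<notin> {a-2, a-1, a+1, a+2}" if "a \<in> Q" for a
      using \<open>i \<in> {b-1, b+1, b+2}\<close> gap[OF that] by auto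
    moreover have "i \<notin> N" using that b(2) by blast
    ultimately show ?thesis using that(1) by (auto simp: chain_locus_def)
  qed
  \<comment> \<open>The unit vector shows that \<open>x\<^sub>b\<^sub>-\<^sub>2\<close> is not identically zero: every monomial of a relation
    is a product of two distinct coordinates and so vanishes at a unit vector.\<close>
  have unit: "(\<lambda>i. of_bool (i = b - 2)) \<in> ?Z"
    using b two by (fastforce simp: chain_locus_def)
  have "integral_on {x \<in> ?Z. x (b-2) * x (b-1) + x (b+1) * x (b+2) = 0}"
    by (rule integral_on_adjoin_relation[OF int _ free unit]) (use b in auto)
  moreover have "{x \<in> ?Z. x (b-2) * x (b-1) + x (b+1) * x (b+2) = 0} =
      chain_locus N (insert b Q)"
    by (auto simp: chain_locus_def)
  ultimately show ?case by simp
qed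

lemma zero_locus_Var_p_k_irreducible:
  assumes "finite Q"
    and Q: "\<And>a. a \<in> Q \<Longrightarrow> 2 \<le> a \<and> N \<inter> {a-2, a-1, a+1, a+2} = {} \<and> {a-2, a-1, a+1, a+2} \<subseteq> W"
    and gaps: "\<And>a b. a \<in> Q \<Longrightarrow> b \<in> Q \<Longrightarrow> a < b \<Longrightarrow> a + 4 \<le> b"
    and "N \<subseteq> W"
  shows "irreducible_set W (zero_locus W (Var ` N \<union> p_k ` Q))"
proof (rule irreducible_set_if_integral_on)
  have "Var ` N \<union> p_k ` Q \<subseteq> carrier (poly_ring W)"
    using Q \<open>N \<subseteq> W\<close> vars_p_k by (fastforce simp: poly_ring_def vars_Var)
  then show "algebraic_set W (zero_locus W (Var ` N \<union> p_k ` Q))"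
    unfolding algebraic_set_def by blast
  \<comment> \<open>Points of the affine space are undefined outside \<open>W\<close>, so restriction is a polynomial map:
    it copies the coordinates in \<open>W\<close> and is constant in all the others.\<close>
  have restrict: "(\<lambda>x. restrict x W) ` chain_locus N Q = zero_locus W (Var ` N \<union> p_k ` Q)"
  proof
    show "(\<lambda>x. restrict x W) ` chain_locus N Q \<subseteq> zero_locus W (Var ` N \<union> p_k ` Q)"
      using Q \<open>N \<subseteq> W\<close> by (force simp: chain_locus_def zero_locus_def affine_space_def)
    show "zero_locus W (Var ` N \<union> p_k ` Q) \<subseteq> (\<lambda>x. restrict x W) ` chain_locus N Q"
    proof
      fix x assume x: "x \<in> zero_locus W (Var ` N \<union> p_k ` Q)"
      then have "\<forall>i\<in>N. peval x (Var i) = 0" "\<forall>a\<in>Q. peval x (p_k a) = 0"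
        unfolding zero_locus_def by blast+
      then have "x \<in> chain_locus N Q" by (simp add: chain_locus_def)
      moreover have "x \<in> W \<rightarrow>\<^sub>E UNIV" using x by (simp add: zero_locus_def affine_space_def)
      then have "x = restrict x W" by (rule PiE_restrict[symmetric])
      ultimately show "x \<in> (\<lambda>x. restrict x W) ` chain_locus N Q" by blast
    qed
  qed
  have "(\<lambda>i. 0) \<in> chain_locus N Q" by (simp add: chain_locus_def)
  then show "zero_locus W (Var ` N \<union> p_k ` Q) \<noteq> {}" using restrict by blast
  have "(\<lambda>x. restrict x W i) \<in> polyfuns" for i
    by (cases "i \<in> W") (auto intro: polyfuns.intros)
  moreover have "integral_on (chain_locus N Q)"
    using assms by (intro integral_on_chain_locus) auto
  ultimately show "integral_on (zero_locus W (Var ` N \<union> p_k ` Q))"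
    using integral_on_image[of _ "\<lambda>x. restrict x W"] restrict by metis
qed

section \<open>The equations of the hyperpath\<close>

lemma hyperpath_incident_edges:
  assumes "1 \<le> n"
  shows "1 \<le> j \<Longrightarrow> j \<le> n \<Longrightarrow> {e \<in> hyperpath_edges n. 2*j \<in> e} = {{2*j-1, 2*j, 2*j+1}}"
    and "{e \<in> hyperpath_edges n. 1 \<in> e} = {{1, 2, 3}}"
    and "{e \<in> hyperpath_edges n. 2*n+1 \<in> e} = {{2*n-1, 2*n, 2*n+1}}"
    and "1 \<le> k \<Longrightarrow> k < n \<Longrightarrow> {e \<in> hyperpath_edges n. 2*k+1 \<in> e} =
           {{2*k-1, 2*k, 2*k+1}, {2*k+1, 2*k+2, 2*k+3}}"
proof -
  let ?e = "\<lambda>j::nat. {2*j-1, 2*j, 2*j+1}"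
  have edges: "{e \<in> hyperpath_edges n. i \<in> e} = ?e ` {j \<in> {1..n}. i \<in> ?e j}" for i
    unfolding hyperpath_edges_def by blast
  show "{e \<in> hyperpath_edges n. 2*j \<in> e} = {?e j}" if "1 \<le> j" "j \<le> n"
  proof -
    have "{l \<in> {1..n}. 2*j \<in> ?e l} = {j}" using that by (auto; presburger)
    then show ?thesis unfolding edges by simp
  qed
  have "{l \<in> {1..n}. 1 \<in> ?e l} = {1}" using assms by auto
  then show "{e \<in> hyperpath_edges n. 1 \<in> e} = {{1, 2, 3}}" unfolding edges by simp
  have "{l \<in> {1..n}. 2*n+1 \<in> ?e l} = {n}" using assms by (auto; presburger)
  then show "{e \<in> hyperpath_edges n. 2*n+1 \<in> e} = {{2*n-1, 2*n, 2*n+1}}"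
    unfolding edges by simp
  show "{e \<in> hyperpath_edges n. 2*k+1 \<in> e} = {?e k, {2*k+1, 2*k+2, 2*k+3}}"
    if "1 \<le> k" "k < n"
  proof -
    have "{l \<in> {1..n}. 2*k+1 \<in> ?e l} = {k, k+1}" using that by (auto; presburger)
    then show ?thesis unfolding edges by (simp add: eval_nat_numeral)
  qed
qed

lemma hyperpath_verts_eq:
  assumes "1 \<le> n"
  shows "hyperpath_verts n = {1, 2*n+1} \<union> (*) 2 ` {1..n} \<union> A_n' n"
proof (rule Set.set_eqI)
  fix i
  show "i \<in> hyperpath_verts n \<longleftrightarrow> i \<in> {1, 2*n+1} \<union> (*) 2 ` {1..n} \<union> A_n' n"
  proof (cases "even i")
    case True
    then obtain j where "i = 2 * j" by blast
    then show ?thesis by (auto simp: hyperpath_verts_def A_n'_def; presburger)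
  next
    case False
    then obtain j where "i = 2 * j + 1" using oddE by blast
    then show ?thesis using assms by (auto simp: hyperpath_verts_def A_n'_def; presburger)
  qed
qed

lemma nullvariety_hyperpath_iff:
  assumes "1 \<le> n"
  shows "x \<in> nullvariety (hyperpath_verts n) (hyperpath_edges n) \<longleftrightarrow>
     x \<in> affine_space (hyperpath_verts n) \<and>
     (\<forall>j\<in>{1..n}. x (2*j-1) * x (2*j+1) = 0) \<and> x 2 * x 3 = 0 \<and> x (2*n-1) * x (2*n) = 0 \<and>
     (\<forall>a\<in>A_n' n. x (a-2) * x (a-1) + x (a+1) * x (a+2) = 0)"
proof -
  define L where "L i = (\<Sum>e\<in>{e\<in>hyperpath_edges n. i \<in> e}. \<Prod>j\<in>e - {i}. x j)" for i
  have even: "L (2*j) = x (2*j-1) * x (2*j+1)" if "j \<in> {1..n}" for j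
  proof -
    have "{2*j-1, 2*j, 2*j+1} - {2*j} = {2*j-1, 2*j+1}" using that by auto
    then show ?thesis using that assms by (simp add: L_def hyperpath_incident_edges)
  qed
  have "{1, 2, 3} - {1::nat} = {2, 3}" by auto
  then have first: "L 1 = x 2 * x 3"
    unfolding L_def hyperpath_incident_edges(2)[OF assms] by simp
  have "{2*n-1, 2*n, 2*n+1} - {2*n+1} = {2*n-1, 2*n}" by auto
  moreover have "2*n-1 \<noteq> 2*n" using assms by auto
  ultimately have last: "L (2*n+1) = x (2*n-1) * x (2*n)"
    unfolding L_def hyperpath_incident_edges(3)[OF assms] by simp
  have odd: "L a = x (a-2) * x (a-1) + x (a+1) * x (a+2)" if a: "a \<in> A_n' n" for a
  proof -
    obtain k where k: "a = 2*k+1" "1 \<le> k" "k < n" using a by (fastforce simp: A_n'_def)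
    have *: "{2*k-1, 2*k, 2*k+1} - {2*k+1} = {2*k-1, 2*k}"
      "{2*k+1, 2*k+2, 2*k+3} - {2*k+1} = {2*k+2, 2*k+3}" by auto
    have "2*k-1 \<notin> {2*k+1, 2*k+2, 2*k+3}" using k by auto
    then have "{2*k-1, 2*k, 2*k+1} \<noteq> {2*k+1, 2*k+2, 2*k+3}" by blast
    then have "L a = (\<Prod>j\<in>{2*k-1, 2*k}. x j) + (\<Prod>j\<in>{2*k+2, 2*k+3}. x j)"
      unfolding L_def k(1) hyperpath_incident_edges(4)[OF assms k(2,3)]
      by (simp only: * sum.insert finite.intros sum.empty singleton_iff not_False_eq_True
          empty_iff add_0_right)
    moreover have "2*k-1 \<noteq> 2*k" "2*k+1-2 = 2*k-1" using k by auto
    ultimately show ?thesis unfolding k(1) by (simp add: eval_nat_numeral)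
  qed
  have "x \<in> nullvariety (hyperpath_verts n) (hyperpath_edges n) \<longleftrightarrow>
      x \<in> affine_space (hyperpath_verts n) \<and> (\<forall>i\<in>hyperpath_verts n. L i = 0)"
    by (simp add: nullvariety_def L_def)
  also have "(\<forall>i\<in>hyperpath_verts n. L i = 0) \<longleftrightarrow>
      (\<forall>j\<in>{1..n}. L (2*j) = 0) \<and> L 1 = 0 \<and> L (2*n+1) = 0 \<and> (\<forall>a\<in>A_n' n. L a = 0)"
    unfolding hyperpath_verts_eq[OF assms] by blast
  finally show ?thesis
    by (simp add: even first[unfolded One_nat_def] last[unfolded Suc_eq_plus1[symmetric]] odd)
qed

section \<open>Admissible sets\<close>

lemma Var_in_U1_iff [simp]: "Var i \<in> U1 S \<longleftrightarrow> i \<in> S"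
  by (auto simp: U1_def)

lemma A_n'_iff: "2*k+1 \<in> A_n' n \<longleftrightarrow> 1 \<le> k \<and> k < n"
  by (auto simp: A_n'_def)

lemma A_n_obtain:
  assumes "a \<in> A_n n"
  obtains k where "a = 2*k+1" "2 \<le> k" "k + 2 \<le> n"
proof -
  obtain k where k: "a = 2*k+1" "1 \<le> k" "k \<le> n-1" "k \<noteq> 1" "k + 1 \<noteq> n"
    using assms by (force simp: A_n_def A_n'_def)
  then show ?thesis by (intro that[of k]) auto
qed

lemma A_n'_eq:
  assumes "n \<ge> 3"
  shows "A_n' n = {3, 2*n-1} \<union> A_n n"
proof -
  have "3 = 2*1+(1::nat)" "2*n-1 = 2*(n-1)+1" using assms by auto
  then have "3 \<in> A_n' n" "2*n-1 \<in> A_n' n" using assms by (simp_all only: A_n'_iff) auto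
  then show ?thesis by (auto simp: A_n_def)
qed

lemma fibonacci_subsetsD:
  assumes "S \<in> fibonacci_subsets n"
  shows "S \<subseteq> A_n' n" "\<And>k. 1 \<le> k \<Longrightarrow> k + 2 \<le> n \<Longrightarrow> 2*k+1 \<in> S \<or> 2*k+3 \<in> S"
  using assms by (auto simp: fibonacci_subsets_def)

lemma U4_vanishes_iff:
  "(\<forall>f\<in>U4 n S. peval x f = 0) \<longleftrightarrow> (\<forall>a\<in>A_n n.
     (a-2 \<in> S \<and> a+2 \<notin> S \<longrightarrow> x (a+1) = 0) \<and> (a-2 \<notin> S \<and> a+2 \<in> S \<longrightarrow> x (a-1) = 0) \<and>
     (a-2 \<notin> S \<and> a+2 \<notin> S \<longrightarrow> peval x (p_k a) = 0))"
  unfolding U4_def by (simp only: ball_UN Var_in_U1_iff) (rule ball_cong; simp)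

text \<open>
  A Fibonacci subset meets every pair of neighbouring odd vertices, which gives the equations at
  the even vertices; at an odd vertex \<open>a\<close> the generators kill both monomials of \<open>p\<^sub>a\<close> unless
  \<open>p\<^sub>a\<close> is itself a generator.
\<close>

lemma admissible_zero_in_nullvariety:
  assumes n: "n \<ge> 3" and S: "S \<in> fibonacci_subsets n" and B: "B \<in> admissible_sets n S"
    and x: "x \<in> zero_locus (hyperpath_verts n) B"
  shows "x \<in> nullvariety (hyperpath_verts n) (hyperpath_edges n)"
proof -
  obtain U2 U3 where U: "U2 \<in> U2_choices S" "U3 \<in> U3_choices n S"
    and B_eq: "B = U1 S \<union> U2 \<union> U3 \<union> U4 n S"
    using B by (auto simp: admissible_sets_def)
  have van: "\<forall>f\<in>U1 S. peval x f = 0" "\<forall>f\<in>U2. peval x f = 0" "\<forall>f\<in>U3. peval x f = 0"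
    "\<forall>f\<in>U4 n S. peval x f = 0"
    using x by (auto simp: zero_locus_def B_eq)
  have xS: "x i = 0" if "i \<in> S" for i
    using van(1) that by (auto simp: U1_def)
  note fib = fibonacci_subsetsD(2)[OF S]
  have "3 \<in> S \<or> 5 \<in> S" using fib[of 1] n by simp
  then have left: "x 1 * x 3 = 0" "x 2 * x 3 = 0" "x 1 * x 2 + x 4 * x 5 = 0"
    using U(1) van(2) xS by (auto simp: U2_choices_def split: if_splits)
  have idx: "2*(n-2)+1 = 2*n-3" "2*(n-2)+3 = 2*n-1" "2*n-1-2 = 2*n-3" "2*n-1-1 = 2*n-2"
    "2*n-1+1 = 2*n" "2*n-1+2 = 2*n+1"
    using n by auto
  have "2*n-3 \<in> S \<or> 2*n-1 \<in> S" using fib[of "n-2"] n unfolding idx by simp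
  then have right: "x (2*n-1) * x (2*n) = 0" "x (2*n-1) * x (2*n+1) = 0"
    "x (2*n-3) * x (2*n-2) + x (2*n) * x (2*n+1) = 0"
  proof (atomize(full), cases "2*n-3 \<in> S")
    case True
    then show "x (2*n-1) * x (2*n) = 0 \<and> x (2*n-1) * x (2*n+1) = 0 \<and>
        x (2*n-3) * x (2*n-2) + x (2*n) * x (2*n+1) = 0"
      using U(2) van(3) xS by (auto simp: U3_choices_def split: if_splits)
  next
    case False
    then have "2*n-1 \<in> S" "U3 = {p_k (2*n-1)}"
      using \<open>2*n-3 \<in> S \<or> 2*n-1 \<in> S\<close> U(2) by (auto simp: U3_choices_def)
    then show "x (2*n-1) * x (2*n) = 0 \<and> x (2*n-1) * x (2*n+1) = 0 \<and>
        x (2*n-3) * x (2*n-2) + x (2*n) * x (2*n+1) = 0"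
      using van(3) xS[of "2*n-1"] peval_p_k[of x "2*n-1"] unfolding idx by simp
  qed
  have consecutive: "x (2*j-1) * x (2*j+1) = 0" if j: "j \<in> {1..n}" for j
  proof -
    consider "j = 1" | "j = n" | "2 \<le> j" "j < n" using j by fastforce
    then show ?thesis
    proof cases
      case 3
      then have "2*(j-1)+1 \<in> S \<or> 2*(j-1)+3 \<in> S" by (intro fib) auto
      moreover have "2*(j-1)+1 = 2*j-1" "2*(j-1)+3 = 2*j+1" using 3 by auto
      ultimately have "2*j-1 \<in> S \<or> 2*j+1 \<in> S" by argo
      then show ?thesis using xS mult_eq_0_iff by blast
    qed (use left right in auto)
  qed
  have "x (a-2) * x (a-1) + x (a+1) * x (a+2) = 0" if a: "a \<in> A_n' n" for a
  proof -
    consider "a = 3" | "a = 2*n-1" | "a \<in> A_n n" using a A_n'_eq[OF n] by blast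
    then show ?thesis
    proof cases
      case 1
      then show ?thesis using left by (simp add: eval_nat_numeral)
    next
      case 2
      show ?thesis unfolding 2 idx by (rule right)
    next
      case 3
      then show ?thesis using van(4) xS[of "a-2"] xS[of "a+2"]
        unfolding U4_vanishes_iff peval_p_k by (metis add_0 mult_zero_left mult_zero_right)
    qed
  qed
  moreover have "x \<in> affine_space (hyperpath_verts n)" using x by (simp add: zero_locus_def)
  ultimately show ?thesis
    using n left right consecutive by (subst nullvariety_hyperpath_iff) auto
qed

text \<open>
  The right \<open>S\<close> is the full set of inner odd vertices where \<open>x\<close> vanishes: where membership in
  \<open>S\<close> fails, the coordinate is nonzero and can be cancelled from the equations.
\<close>

lemma nullvariety_point_in_admissible_zero_locus:
  assumes n: "n \<ge> 3" and x: "x \<in> nullvariety (hyperpath_verts n) (hyperpath_edges n)"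
  shows "\<exists>S\<in>fibonacci_subsets n. \<exists>B\<in>admissible_sets n S. x \<in> zero_locus (hyperpath_verts n) B"
proof -
  have aff: "x \<in> affine_space (hyperpath_verts n)"
    and consecutive: "\<And>j. j \<in> {1..n} \<Longrightarrow> x (2*j-1) * x (2*j+1) = 0"
    and ends: "x 2 * x 3 = 0" "x (2*n-1) * x (2*n) = 0"
    and p: "\<And>a. a \<in> A_n' n \<Longrightarrow> x (a-2) * x (a-1) + x (a+1) * x (a+2) = 0"
    using x n by (subst (asm) nullvariety_hyperpath_iff; simp)+
  define S where "S = {a \<in> A_n' n. x a = 0}"
  have S_iff: "2*k+1 \<in> S \<longleftrightarrow> x (2*k+1) = 0" if "1 \<le> k" "k < n" for k
    using that by (simp add: S_def A_n'_iff del: One_nat_def)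
  have idx: "2*(n-2)+1 = 2*n-3" "2*(n-1)+1 = 2*n-1" "2*n-1-2 = 2*n-3" "2*n-1-1 = 2*n-2"
    "2*n-1+1 = 2*n" "2*n-1+2 = 2*n+1"
    using n by auto
  have S_ends: "3 \<in> S \<longleftrightarrow> x 3 = 0" "5 \<in> S \<longleftrightarrow> x 5 = 0"
    "2*n-3 \<in> S \<longleftrightarrow> x (2*n-3) = 0" "2*n-1 \<in> S \<longleftrightarrow> x (2*n-1) = 0"
    using S_iff[of 1] S_iff[of 2] S_iff[of "n-2"] S_iff[of "n-1"] n unfolding idx by simp_all
  have S: "S \<in> fibonacci_subsets n"
    unfolding fibonacci_subsets_def
  proof (intro CollectI conjI ballI)
    fix k assume "k \<in> {1..n-2}"
    then have k: "1 \<le> k" "k + 1 < n" using n by auto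
    have next_odd: "2*(k+1)+1 = 2*k+3" "2*(k+1)-1 = 2*k+1" by simp_all
    have "x (2*k+1) * x (2*k+3) = 0" using consecutive[of "k+1"] k unfolding next_odd by simp
    then show "2*k+1 \<in> S \<or> 2*k+3 \<in> S"
      using S_iff[of k] S_iff[of "k+1"] k unfolding next_odd mult_eq_0_iff by linarith
  qed (auto simp: S_def)
  have left: "x 1 * x 3 = 0" "x 3 * x 5 = 0" "x 1 * x 2 + x 4 * x 5 = 0"
    using consecutive[of 1] consecutive[of 2] p[of 3] A_n'_eq[OF n] n
    by (simp_all add: eval_nat_numeral)
  have right: "x (2*n-3) * x (2*n-1) = 0" "x (2*n-1) * x (2*n+1) = 0"
    "x (2*n-3) * x (2*n-2) + x (2*n) * x (2*n+1) = 0"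
  proof -
    have "2*(n-1)-1 = 2*n-3" by simp
    then show "x (2*n-3) * x (2*n-1) = 0" using consecutive[of "n-1"] n unfolding idx by simp
    show "x (2*n-1) * x (2*n+1) = 0" using consecutive[of n] n by simp
    show "x (2*n-3) * x (2*n-2) + x (2*n) * x (2*n+1) = 0"
      using p[of "2*n-1"] A_n'_eq[OF n] unfolding idx by simp
  qed
  have "\<exists>U\<in>U2_choices S. \<forall>f\<in>U. peval x f = 0"
    using left ends(1) by (auto simp: U2_choices_def S_ends)
  moreover have "\<exists>U\<in>U3_choices n S. \<forall>f\<in>U. peval x f = 0"
  proof -
    have "peval x (p_k (2*n-1)) = 0" unfolding peval_p_k idx by (rule right)
    then show ?thesis using right ends(2)
      unfolding U3_choices_def Var_in_U1_iff S_ends by auto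
  qed
  moreover have "\<forall>f\<in>U4 n S. peval x f = 0"
    unfolding U4_vanishes_iff
  proof
    fix a assume a: "a \<in> A_n n"
    obtain k where k: "a = 2*k+1" "2 \<le> k" "k + 2 \<le> n" using A_n_obtain[OF a] .
    have "a-2 = 2*(k-1)+1" "a+2 = 2*(k+1)+1" using k by auto
    then have "a-2 \<in> S \<longleftrightarrow> x (a-2) = 0" "a+2 \<in> S \<longleftrightarrow> x (a+2) = 0"
      using S_iff[of "k-1"] S_iff[of "k+1"] k by auto
    moreover have "x (a-2) * x (a-1) + x (a+1) * x (a+2) = 0"
      using p a by (simp add: A_n_def)
    ultimately show "(a-2 \<in> S \<and> a+2 \<notin> S \<longrightarrow> x (a+1) = 0) \<and> (a-2 \<notin> S \<and> a+2 \<in> S \<longrightarrow> x (a-1) = 0) \<and>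
        (a-2 \<notin> S \<and> a+2 \<notin> S \<longrightarrow> peval x (p_k a) = 0)"
      by auto
  qed
  moreover have "\<forall>f\<in>U1 S. peval x f = 0" by (auto simp: U1_def S_def)
  ultimately obtain U2 U3 where "U2 \<in> U2_choices S" "U3 \<in> U3_choices n S"
    "\<forall>f\<in>U1 S \<union> U2 \<union> U3 \<union> U4 n S. peval x f = 0"
    by blast
  then have "U1 S \<union> U2 \<union> U3 \<union> U4 n S \<in> admissible_sets n S"
    "x \<in> zero_locus (hyperpath_verts n) (U1 S \<union> U2 \<union> U3 \<union> U4 n S)"
    using aff by (auto simp: admissible_sets_def zero_locus_def)
  then show ?thesis using S by blast
qed

lemma U2_shape:
  assumes "U \<in> U2_choices S"
  shows "\<exists>N. U = Var ` N \<union> p_k ` {a. a = 3 \<and> 5 \<notin> S} \<and> N \<subseteq> {1, 2} \<and> (N \<noteq> {} \<longrightarrow> 5 \<in> S)"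
proof -
  consider "5 \<in> S" "U = Var ` {1, 2}" | "5 \<in> S" "U = Var ` {1}" | "5 \<in> S" "U = Var ` {2}"
    | "5 \<notin> S" "U = p_k ` {3}"
    using assms by (auto simp: U2_choices_def split: if_splits)
  then show ?thesis
  proof cases
    case 4 then show ?thesis by (intro exI[of _ "{}"]) auto
  qed (fastforce intro: exI[of _ "{1, 2}"] exI[of _ "{1}"] exI[of _ "{2}"])+
qed

lemma U3_shape:
  assumes "U \<in> U3_choices n S"
  shows "\<exists>N. U = Var ` N \<union> p_k ` {a. a = 2*n-1 \<and> 2*n-3 \<notin> S} \<and> N \<subseteq> {2*n, 2*n+1} \<and>
    (N \<noteq> {} \<longrightarrow> 2*n-3 \<in> S)"
proof -
  consider "2*n-3 \<in> S" "U = Var ` {2*n, 2*n+1}" | "2*n-3 \<in> S" "U = Var ` {2*n}"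
    | "2*n-3 \<in> S" "U = Var ` {2*n+1}" | "2*n-3 \<notin> S" "U = p_k ` {2*n-1}"
    using assms by (auto simp: U3_choices_def split: if_splits)
  then show ?thesis
  proof cases
    case 4 then show ?thesis by (intro exI[of _ "{}"]) auto
  qed (fastforce intro: exI[of _ "{2*n, 2*n+1}"] exI[of _ "{2*n}"] exI[of _ "{2*n+1}"])+
qed

lemma U4_shape:
  "U4 n S = Var ` ({a+1 | a. a \<in> A_n n \<and> a-2 \<in> S \<and> a+2 \<notin> S} \<union>
                   {a-1 | a. a \<in> A_n n \<and> a-2 \<notin> S \<and> a+2 \<in> S})
            \<union> p_k ` {a \<in> A_n n. a-2 \<notin> S \<and> a+2 \<notin> S}"
  unfolding U4_def Var_in_U1_iff by (auto split: if_splits)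

text \<open>
  Generators of the form \<open>p\<^sub>a\<close> occur exactly at the vertices \<open>a\<close> both of whose odd neighbours lie
  outside \<open>S\<close>; the vertices \<open>1\<close> and \<open>2n+1\<close> always do, which makes the end cases follow the same
  rule. The Fibonacci condition then forces \<open>a \<in> S\<close>, and this separates the generators: \<open>a+2\<close>
  cannot be another such vertex, and no coordinate occurring in \<open>p\<^sub>a\<close> is itself a generator.
\<close>

lemma admissible_set_shape:
  assumes n: "n \<ge> 3" and S: "S \<in> fibonacci_subsets n" and B: "B \<in> admissible_sets n S"
  obtains N Q where "B = Var ` N \<union> p_k ` Q" "finite Q" "N \<subseteq> hyperpath_verts n"
    "\<And>a. a \<in> Q \<Longrightarrow> 2 \<le> a \<and> N \<inter> {a-2, a-1, a+1, a+2} = {} \<and>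
           {a-2, a-1, a+1, a+2} \<subseteq> hyperpath_verts n"
    "\<And>a b. a \<in> Q \<Longrightarrow> b \<in> Q \<Longrightarrow> a < b \<Longrightarrow> a + 4 \<le> b"
proof -
  obtain U2 U3 where U: "U2 \<in> U2_choices S" "U3 \<in> U3_choices n S"
    and B_eq: "B = U1 S \<union> U2 \<union> U3 \<union> U4 n S"
    using B by (auto simp: admissible_sets_def)
  obtain N2 where N2: "U2 = Var ` N2 \<union> p_k ` {a. a = 3 \<and> 5 \<notin> S}" "N2 \<subseteq> {1, 2}"
    "N2 \<noteq> {} \<longrightarrow> 5 \<in> S"
    using U2_shape[OF U(1)] by blast
  obtain N3 where N3: "U3 = Var ` N3 \<union> p_k ` {a. a = 2*n-1 \<and> 2*n-3 \<notin> S}"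
    "N3 \<subseteq> {2*n, 2*n+1}" "N3 \<noteq> {} \<longrightarrow> 2*n-3 \<in> S"
    using U3_shape[OF U(2)] by blast
  define N4 where "N4 = {a+1 | a. a \<in> A_n n \<and> a-2 \<in> S \<and> a+2 \<notin> S} \<union>
                        {a-1 | a. a \<in> A_n n \<and> a-2 \<notin> S \<and> a+2 \<in> S}"
  define Q where "Q = {a \<in> A_n' n. a-2 \<notin> S \<and> a+2 \<notin> S}"
  define N where "N = S \<union> N2 \<union> N3 \<union> N4"
  have SA: "S \<subseteq> A_n' n" by (rule fibonacci_subsetsD(1)[OF S])
  have A'_bounds: "odd a \<and> 3 \<le> a \<and> a + 1 \<le> 2*n" if "a \<in> A_n' n" for a
    using that by (auto simp: A_n'_def)
  \<comment> \<open>For \<open>a = 3\<close> and \<open>a = 2n-1\<close> one of the two conditions in \<open>Q\<close> holds automatically.\<close>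
  have "2*n+1 \<notin> S" "1 \<notin> S" using SA A'_bounds by fastforce+
  moreover have "2*n-1+2 = 2*n+1" "2*n-1-2 = 2*n-3" using n by auto
  ultimately have Q_eq: "Q = {a. a = 3 \<and> 5 \<notin> S} \<union> {a. a = 2*n-1 \<and> 2*n-3 \<notin> S} \<union>
      {a \<in> A_n n. a-2 \<notin> S \<and> a+2 \<notin> S}"
    unfolding Q_def A_n'_eq[OF n] by auto
  have Q_in_S: "a \<in> S" if a: "a \<in> Q" for a
  proof -
    obtain k where k: "a = 2*k+1" "1 \<le> k" "k < n" using a by (fastforce simp: Q_def A_n'_def)
    show ?thesis
    proof (cases "k = 1")
      case True
      then show ?thesis
        using fibonacci_subsetsD(2)[OF S, of 1] n a k by (auto simp: Q_def)
    next
      case False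
      then have shift: "2*(k-1)+1 = a-2" "2*(k-1)+3 = a" and "1 \<le> k-1" "k-1+2 \<le> n"
        using k by auto
      from fibonacci_subsetsD(2)[OF S this(3,4)] have "a-2 \<in> S \<or> a \<in> S"
        unfolding shift .
      then show ?thesis using a by (simp add: Q_def)
    qed
  qed
  show ?thesis
  proof (rule that[of N Q])
    have regroup: "T \<union> (T2 \<union> R2) \<union> (T3 \<union> R3) \<union> (T4 \<union> R4) = (T \<union> T2 \<union> T3 \<union> T4) \<union> (R2 \<union> R3 \<union> R4)"
      for T T2 T3 T4 R2 R3 R4 :: "cpoly set" by blast
    show "B = Var ` N \<union> p_k ` Q"
      unfolding B_eq N2(1) N3(1) U4_shape[of n S, folded N4_def] U1_def N_def Q_eq image_Un
      by (rule regroup)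
    have "Q \<subseteq> {..2*n}"
    proof
      fix a assume "a \<in> Q"
      then show "a \<in> {..2*n}" using A'_bounds[of a] by (simp add: Q_def)
    qed
    then show "finite Q" by (rule finite_subset) simp
    have "N4 \<subseteq> hyperpath_verts n"
      using A'_bounds by (fastforce simp: N4_def A_n_def hyperpath_verts_def)
    moreover have "S \<subseteq> hyperpath_verts n"
      using SA hyperpath_verts_eq[of n] n by auto
    ultimately show "N \<subseteq> hyperpath_verts n"
      using N2(2) N3(2) n by (auto simp: N_def hyperpath_verts_def)
    show "a + 4 \<le> b" if "a \<in> Q" "b \<in> Q" "a < b" for a b
    proof -
      have "odd a" "odd b" using that A'_bounds[of a] A'_bounds[of b] by (auto simp: Q_def)
      moreover have "b \<noteq> a + 2" using Q_in_S[OF that(2)] that(1) by (auto simp: Q_def)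
      moreover from calculation have "b \<noteq> a + 1" "b \<noteq> a + 3" by auto
      ultimately show ?thesis using that(3) by simp
    qed
    fix a assume a: "a \<in> Q"
    then have aQ: "a \<in> A_n' n" "a-2 \<notin> S" "a+2 \<notin> S" "a \<in> S"
      using Q_in_S[OF a] by (simp_all add: Q_def)
    note ab = A'_bounds[OF aQ(1)]
    have "i \<notin> {a-2, a-1, a+1, a+2}" if i: "i \<in> S" for i
    proof -
      have "odd i" using A'_bounds[of i] i SA by auto
      then have "i \<noteq> a-1" "i \<noteq> a+1" using ab by auto
      then show ?thesis using aQ i by auto
    qed
    moreover have "i \<notin> {a-2, a-1, a+1, a+2}" if i: "i \<in> N2" for i
    proof
      have "i = 1 \<or> i = 2" "5 \<in> S" using i N2(2,3) by auto
      assume "i \<in> {a-2, a-1, a+1, a+2}"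
      then have "i = a-2 \<or> i = a-1 \<or> i = a+1 \<or> i = a+2" by simp
      moreover have "a \<noteq> 4" using ab by auto
      ultimately have "a = 3" using \<open>i = 1 \<or> i = 2\<close> ab by (elim disjE) auto
      then show False using \<open>5 \<in> S\<close> aQ by simp
    qed
    moreover have "i \<notin> {a-2, a-1, a+1, a+2}" if i: "i \<in> N3" for i
    proof
      have "i = 2*n \<or> i = 2*n+1" "2*n-3 \<in> S" using i N3(2,3) by auto
      assume "i \<in> {a-2, a-1, a+1, a+2}"
      then have "i = a-2 \<or> i = a-1 \<or> i = a+1 \<or> i = a+2" by simp
      moreover have "odd (a+2)" "i \<noteq> 2*n \<or> even i" using ab by auto
      ultimately have "a + 1 = 2*n"
        using \<open>i = 2*n \<or> i = 2*n+1\<close> ab by (elim disjE) auto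
      then have "2*n-3 = a-2" by simp
      then show False using \<open>2*n-3 \<in> S\<close> aQ by simp
    qed
    moreover have "i \<notin> {a-2, a-1, a+1, a+2}" if i: "i \<in> N4" for i
    proof
      assume i': "i \<in> {a-2, a-1, a+1, a+2}"
      \<comment> \<open>An even coordinate of \<open>p\<^sub>a\<close> lies in an edge of \<open>a\<close>, so the vertex \<open>b\<close> that made it a
        generator is \<open>a\<close> itself or an odd neighbour of \<open>a\<close>; each choice contradicts the
        membership pattern at \<open>b\<close>.\<close>
      obtain b where b: "b \<in> A_n' n"
        and cases: "i = b+1 \<and> b-2 \<in> S \<and> b+2 \<notin> S \<or> i = b-1 \<and> b-2 \<notin> S \<and> b+2 \<in> S"
        using i by (auto simp: N4_def A_n_def)
      note bb = A'_bounds[OF b]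
      have "i = a-2 \<or> i = a-1 \<or> i = a+1 \<or> i = a+2" using i' by simp
      moreover have "i = b+1 \<or> i = b-1" using cases by blast
      moreover have "even i" "odd (a-2)" "odd (a+2)"
        using \<open>i = b+1 \<or> i = b-1\<close> ab bb by auto
      ultimately have "i = a-1 \<or> i = a+1" by metis
      then have "a = b \<or> i = b+1 \<and> a = b+2 \<or> i = b-1 \<and> a = b-2"
        using \<open>i = b+1 \<or> i = b-1\<close> ab bb by (elim disjE) auto
      then show False using cases aQ bb by auto
    qed
    ultimately have "N \<inter> {a-2, a-1, a+1, a+2} = {}" unfolding N_def by blast
    moreover have "{a-2, a-1, a+1, a+2} \<subseteq> hyperpath_verts n"
      using ab by (auto simp: hyperpath_verts_def)
    ultimately show "2 \<le> a \<and> N \<inter> {a-2, a-1, a+1, a+2} = {} \<and>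
        {a-2, a-1, a+1, a+2} \<subseteq> hyperpath_verts n"
      using ab by auto
  qed
qed

lemma finite_admissible_ideals: "finite (admissible_ideals n)"
proof -
  have "A_n' n \<subseteq> {..2*n}" by (auto simp: A_n'_def)
  then have "finite (A_n' n)" by (rule finite_subset) simp
  then have "finite (Pow (A_n' n))" by simp
  moreover have "fibonacci_subsets n \<subseteq> Pow (A_n' n)"
    unfolding fibonacci_subsets_def by blast
  ultimately have "finite (fibonacci_subsets n)" by (rule finite_subset[rotated])
  moreover have "finite (admissible_sets n S)" for S
  proof -
    have "admissible_sets n S =
        (\<lambda>(U2, U3). U1 S \<union> U2 \<union> U3 \<union> U4 n S) ` (U2_choices S \<times> U3_choices n S)"
      unfolding admissible_sets_def by (rule Set.set_eqI) (simp add: image_iff; blast)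
    moreover have "finite (U2_choices S)" "finite (U3_choices n S)"
      by (simp_all add: U2_choices_def U3_choices_def)
    ultimately show ?thesis by simp
  qed
  moreover have "admissible_ideals n = (\<Union>S\<in>fibonacci_subsets n.
      genideal (poly_ring (hyperpath_verts n)) ` admissible_sets n S)"
    unfolding admissible_ideals_def by blast
  ultimately show ?thesis by simp
qed

lemma zero_locus_admissible_ideal:
  assumes "n \<ge> 3" "S \<in> fibonacci_subsets n" "B \<in> admissible_sets n S"
  shows "zero_locus (hyperpath_verts n) (Idl\<^bsub>poly_ring (hyperpath_verts n)\<^esub> B) =
           zero_locus (hyperpath_verts n) B"
    and "irreducible_set (hyperpath_verts n) (zero_locus (hyperpath_verts n) B)"
proof -
  let ?W = "hyperpath_verts n"
  have "B \<subseteq> carrier (poly_ring ?W) \<and> irreducible_set ?W (zero_locus ?W B)"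
  proof (rule admissible_set_shape[OF assms], intro conjI)
    fix N Q assume B: "B = Var ` N \<union> p_k ` Q" and "finite Q" and N: "N \<subseteq> ?W"
      and Q: "\<And>a. a \<in> Q \<Longrightarrow>
        2 \<le> a \<and> N \<inter> {a-2, a-1, a+1, a+2} = {} \<and> {a-2, a-1, a+1, a+2} \<subseteq> ?W"
      and gaps: "\<And>a b. a \<in> Q \<Longrightarrow> b \<in> Q \<Longrightarrow> a < b \<Longrightarrow> a + 4 \<le> b"
    have "vars (p_k a) \<subseteq> ?W" if "a \<in> Q" for a
      using vars_p_k[of a] Q[OF that] by (meson order_trans)
    then show "B \<subseteq> carrier (poly_ring ?W)"
      using N by (auto simp: B poly_ring_def vars_Var)
    show "irreducible_set ?W (zero_locus ?W B)"
      unfolding B by (rule zero_locus_Var_p_k_irreducible[OF \<open>finite Q\<close> Q gaps N])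
  qed
  then show "zero_locus ?W (Idl\<^bsub>poly_ring ?W\<^esub> B) = zero_locus ?W B"
    and "irreducible_set ?W (zero_locus ?W B)"
    by (simp_all add: zero_locus_genideal)
qed

lemma nullvariety_eq_Union_admissible:
  assumes "n \<ge> 3"
  shows "nullvariety (hyperpath_verts n) (hyperpath_edges n) =
           \<Union>(zero_locus (hyperpath_verts n) ` admissible_ideals n)"
proof (rule Set.set_eqI)
  fix x
  have "x \<in> nullvariety (hyperpath_verts n) (hyperpath_edges n) \<longleftrightarrow>
    (\<exists>S\<in>fibonacci_subsets n. \<exists>B\<in>admissible_sets n S. x \<in> zero_locus (hyperpath_verts n) B)"
    using nullvariety_point_in_admissible_zero_locus admissible_zero_in_nullvariety assms by blast
  also have "\<dots> \<longleftrightarrow> (\<exists>S\<in>fibonacci_subsets n. \<exists>B\<in>admissible_sets n S.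
      x \<in> zero_locus (hyperpath_verts n) (Idl\<^bsub>poly_ring (hyperpath_verts n)\<^esub> B))"
    by (simp add: zero_locus_admissible_ideal(1)[OF assms])
  also have "\<dots> \<longleftrightarrow> x \<in> \<Union>(zero_locus (hyperpath_verts n) ` admissible_ideals n)"
    unfolding admissible_ideals_def by blast
  finally show "x \<in> nullvariety (hyperpath_verts n) (hyperpath_edges n) \<longleftrightarrow>
    x \<in> \<Union>(zero_locus (hyperpath_verts n) ` admissible_ideals n)" .
qed

theorem theorem2p7:
  fixes n :: nat
  assumes "n \<ge> 3"
  shows "nullvariety (hyperpath_verts n) (hyperpath_edges n) =
           (\<Union>J\<in>maximal_variety_ideals n. zero_locus (hyperpath_verts n) J) \<and>
         (\<forall>J\<in>maximal_variety_ideals n.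
            irreducible_component (hyperpath_verts n)
              (nullvariety (hyperpath_verts n) (hyperpath_edges n))
              (zero_locus (hyperpath_verts n) J))"
proof -
  let ?V = "zero_locus (hyperpath_verts n)"
  define C where "C = ?V ` admissible_ideals n"
  have V0: "nullvariety (hyperpath_verts n) (hyperpath_edges n) = \<Union>C"
    unfolding C_def by (rule nullvariety_eq_Union_admissible[OF assms])
  have fin: "finite C" by (simp add: C_def finite_admissible_ideals)
  have irr: "irreducible_set (hyperpath_verts n) Z" if Z: "Z \<in> C" for Z
  proof -
    obtain S B where "S \<in> fibonacci_subsets n" "B \<in> admissible_sets n S"
      "Z = ?V (Idl\<^bsub>poly_ring (hyperpath_verts n)\<^esub> B)"
      using Z unfolding C_def admissible_ideals_def by blast
    then show ?thesis using zero_locus_admissible_ideal[OF assms] by simp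
  qed
  have max_iff: "J \<in> maximal_variety_ideals n \<longleftrightarrow>
      J \<in> admissible_ideals n \<and> (\<forall>Y\<in>C. ?V J \<subseteq> Y \<longrightarrow> Y = ?V J)" for J
    unfolding maximal_variety_ideals_def C_def by blast
  have in_maximal: "\<exists>J\<in>maximal_variety_ideals n. Z \<subseteq> ?V J" if Z: "Z \<in> C" for Z
  proof -
    obtain M where "M \<in> C" "Z \<subseteq> M" "\<forall>Y\<in>C. M \<subseteq> Y \<longrightarrow> M = Y"
      using finite_has_maximal2[OF fin Z] by blast
    moreover from \<open>M \<in> C\<close> obtain J where "J \<in> admissible_ideals n" "M = ?V J"
      unfolding C_def by blast
    ultimately have "J \<in> maximal_variety_ideals n" unfolding max_iff by auto
    with \<open>Z \<subseteq> M\<close> \<open>M = ?V J\<close> show ?thesis by blast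
  qed
  have V_in_C: "?V J \<in> C" if "J \<in> maximal_variety_ideals n" for J
    using that unfolding max_iff C_def by blast
  have "\<Union>C = (\<Union>J\<in>maximal_variety_ideals n. ?V J)"
  proof
    show "\<Union>C \<subseteq> (\<Union>J\<in>maximal_variety_ideals n. ?V J)"
    proof
      fix x assume "x \<in> \<Union>C"
      then obtain Z where "Z \<in> C" "x \<in> Z" by blast
      with in_maximal[of Z] show "x \<in> (\<Union>J\<in>maximal_variety_ideals n. ?V J)" by auto
    qed
    show "(\<Union>J\<in>maximal_variety_ideals n. ?V J) \<subseteq> \<Union>C"
      using V_in_C by (intro UN_least Union_upper)
  qed
  moreover have "irreducible_component (hyperpath_verts n) (\<Union>C) (?V J)"
    if J: "J \<in> maximal_variety_ideals n" for J
  proof (rule maximal_members_are_irreducible_components[OF fin irr V_in_C[OF J]])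
    show "Y = ?V J" if "Y \<in> C" "?V J \<subseteq> Y" for Y
      using J that unfolding max_iff by blast
  qed
  ultimately show ?thesis unfolding V0 by blast
qed

end
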